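(* Let $p$ be an odd positive integer, $m\ge2$, and let $\Phi=\mathcal S_p^{(\delta t)}$ and $\Psi=\mathcal S_p^{(m\delta t)}$. Suppose that neither the fine-grid CFL number $\alpha\delta t/h$ nor the coarse-grid CFL number $m\alpha\delta t/h$ is an integer. Then, over all space-time Fourier modes, the MGRIT spectral radius satisfies the following lower bound, independent of the number $\nu\in\mathbb{N}_0$ of CF-relaxations (as $h\to0$ with the CFL number fixed): $$\max_{(\omega,\theta)\in[-\pi,\pi)\times\Theta^{\rm low}}\rho\big(\widehat{\mathcal E}(\omega,\theta)\big)\ \ge\ \check\rho_p\big(\varepsilon^{(\delta t)}\big)\big(1+\mathcal O(h)\big),$$ where $$\check\rho_p\big(\varepsilon^{(\delta t)}\big):=m\,\frac{f_{p+1}\big(\varepsilon^{(\delta t)}\big)}{f_{p+1}\big(\varepsilon^{(m\delta t)}\big)}-1,\qquad \varepsilon^{(\delta t)}\in\Upsilon_m .$$ Furthermore, $\check\rho_p$ is larger than unity for an interval of fine-grid CFL numbers $\varepsilon^{(\delta t)}$ that quickly covers $\Upsilon_m$ as $m$ increases; more precisely, for $m\ge2$, $$\check\rho_p\big(\varepsilon^{(\delta t)}\big)>1\quad\text{when}\quad \varepsilon^{(\delta t)}\in\Upsilon_m\cap\Big(\frac{2}{3m},\,1-\frac{2}{3m}\Big).$$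
   Context: Consider the advection equation $u_t+\alpha u_x=0$, $\alpha>0$, on $x\in(-1,1)$ with periodic boundary conditions, on an equispaced spatial mesh with $n_x$ points $x_i$ and spacing $h$. Let $m$ be the MGRIT coarsening factor and $\delta t>0$ the fine time step. For a time step $\tau>0$ put $c_\tau=\alpha\tau/h$ and $\varepsilon^{(\tau)}=c_\tau-\lfloor c_\tau\rfloor\in[0,1)$; in particular $\varepsilon^{(m\delta t)}=m\varepsilon^{(\delta t)}-\lfloor m\varepsilon^{(\delta t)}\rfloor$. Let $\Upsilon_m=(0,1)\setminus\{\varepsilon: m\varepsilon-\lfloor m\varepsilon\rfloor=0\}$; the CFL assumption in the claim is equivalent to $\varepsilon^{(\delta t)}\in\Upsilon_m$. The polynomial $f_{p+1}$ is $$f_{p+1}(z)=\frac1{(p+1)!}\prod_{q=-\frac{p+1}2}^{\frac{p-1}2}(q+z).$$ $\mathcal S_p^{(\tau)}\in\mathbb{R}^{n_x\times n_x}$ is the semi-Lagrangian time-stepping operator of odd order $p$: characteristics are traced back from $x_i$ to $x_i-\alpha\tau$, and the mesh function is evaluated there by degree-$p$ polynomial interpolation on the $p+1$ nearest mesh points. Explicitly, with indices modulo $n_x$, $(\mathcal S_p^{(\tau)}v)_i=\sum_{j=-(p+1)/2}^{(p-1)/2}\ell_j(-\varepsilon^{(\tau)})\,v_{i-\lfloor c_\tau\rfloor+j}$, where $\ell_j$ is the Lagrange basis polynomial with $\ell_j(k)=\delta_{jk}$ on the integer nodes $k\in\{-\frac{p+1}2,\dots,\frac{p-1}2\}$. It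 is circulant with eigenvalue $s_p^{(\tau)}(\omega)=e^{-\mathrm i\omega\lfloor c_\tau\rfloor}\sum_j\ell_j(-\varepsilon^{(\tau)})e^{\mathrm i\omega j}$ on the spatial Fourier mode $\exp(\mathrm i\omega x/h)$, where $\omega$ ranges over $n_x$ equispaced frequencies in $[-\pi,\pi)$ with spacing $2\pi/n_x=\mathcal O(h)$. Let $\lambda(\omega)=s_p^{(\delta t)}(\omega)$, $\mu(\omega)=s_p^{(m\delta t)}(\omega)$, $\Theta^{\rm low}=[-\pi/m,\pi/m)$, $\widetilde A_1(\omega,m\theta)=1-\mu(\omega)e^{-\mathrm i m\theta}$, $\widetilde A_1^{\rm ideal}(\omega,m\theta)=1-[\lambda(\omega)]^me^{-\mathrm i m\theta}$. The MGRIT spectral radius at $(\omega,\theta)$, with $\nu\in\mathbb{N}_0$ CF-relaxation sweeps in the pre-relaxation, is $$\rho\big(\widehat{\mathcal E}(\omega,\theta)\big)=|\lambda(\omega)|^{m\nu}\left|\frac{\widetilde A_1(\omega,m\theta)-\widetilde A_1^{\rm ideal}(\omega,m\theta)}{\widetilde A_1(\omega,m\theta)}\right|,$$ the constant mode $\omega=0$ (for which $\lambda^m=\mu=1$ and the error propagator is zero) being assigned the value $0$. The constant in $\mathcal O(h)$ may depend on $p,m,\nu$ and the CFL number, not on $h$. *)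

theory Defs
  imports "HOL-Analysis.Analysis" "HOL-Library.Landau_Symbols" "HOL-Library.Extended_Real"
begin

definition mesh_width :: "nat \<Rightarrow> real" where
  "mesh_width n = 2 / real n"

definition mesh_point :: "nat \<Rightarrow> nat \<Rightarrow> real" where
  "mesh_point n i = - 1 + real i * mesh_width n"

definition stencil :: "nat \<Rightarrow> int set" where
  "stencil p = {- ((int p + 1) div 2) .. (int p - 1) div 2}"

definition lagrange_basis :: "nat \<Rightarrow> int \<Rightarrow> real \<Rightarrow> real" where
  "lagrange_basis p j x =
     (\<Prod>k\<in>stencil p - {j}. (x - real_of_int k) / (real_of_int j - real_of_int k))"

text \<open>A mesh function on the periodic mesh with \<open>n\<close> points is given by its values at the
  indices \<open>0, \<dots>, n - 1\<close>. The scalars are the reals, but the operator is also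
  applied to complex Fourier modes, hence the general value type.\<close>

definition semi_lagrangian ::
    "nat \<Rightarrow> nat \<Rightarrow> real \<Rightarrow> real \<Rightarrow> (nat \<Rightarrow> 'a::real_vector) \<Rightarrow> nat \<Rightarrow> 'a" where
  "semi_lagrangian p n \<alpha> \<tau> v i =
     (let c = \<alpha> * \<tau> / mesh_width n in
      \<Sum>j\<in>stencil p. lagrange_basis p j (- frac c) *\<^sub>R v (nat ((int i - \<lfloor>c\<rfloor> + j) mod int n)))"

definition frequencies :: "nat \<Rightarrow> real set" where
  "frequencies n = {\<omega> \<in> {- pi ..< pi}. \<exists>k::int. \<omega> = 2 * pi * real_of_int k / real n}"

definition fourier_mode :: "nat \<Rightarrow> real \<Rightarrow> nat \<Rightarrow> complex" where
  "fourier_mode n \<omega> i = cis (\<omega> * mesh_point n i / mesh_width n)"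

definition fourier_eigenvalue ::
    "nat \<Rightarrow> ((nat \<Rightarrow> complex) \<Rightarrow> nat \<Rightarrow> complex) \<Rightarrow> real \<Rightarrow> complex" where
  "fourier_eigenvalue n T \<omega> = (THE z. \<forall>i<n. T (fourier_mode n \<omega>) i = z * fourier_mode n \<omega> i)"

definition sl_symbol :: "nat \<Rightarrow> real \<Rightarrow> real \<Rightarrow> complex" where
  "sl_symbol p c \<omega> = cis (- \<omega> * real_of_int \<lfloor>c\<rfloor>) *
     (\<Sum>j\<in>stencil p. of_real (lagrange_basis p j (- frac c)) * cis (\<omega> * real_of_int j))"

lemma fourier_mode_shift:
  assumes n: "n > 0" and w: "\<omega> \<in> frequencies n"
  shows "fourier_mode n \<omega> (nat ((int i + d) mod int n)) =
         cis (\<omega> * real_of_int d) * fourier_mode n \<omega> i"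
proof -
  obtain k :: int where k: "\<omega> = 2 * pi * real_of_int k / real n"
    using w unfolding frequencies_def by blast
  define r where "r = (int i + d) mod int n"
  define q where "q = (int i + d) div int n"
  have r: "r \<ge> 0" using n by (simp add: r_def)
  have "int i + d = q * int n + r" by (simp add: q_def r_def)
  then have req: "real_of_int r = real i + real_of_int d - real_of_int q * real n"
    by (metis add_diff_cancel_left' of_int_add of_int_mult of_int_of_nat_eq)
  have mode: "fourier_mode n \<omega> j = cis (\<omega> * real j - \<omega> * real n / 2)" for j
  proof -
    have "\<omega> * mesh_point n j / mesh_width n = \<omega> * real j - \<omega> * real n / 2"
      using n by (simp add: mesh_point_def mesh_width_def divide_simps) (simp add: algebra_simps)
    then show ?thesis by (simp add: fourier_mode_def)
  qed
  have wn: "\<omega> * real n = 2 * pi * real_of_int k" using n by (simp add: k)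
  have "\<omega> * real (nat r) - \<omega> * real n / 2 =
        (\<omega> * real_of_int d + (\<omega> * real i - \<omega> * real n / 2)) - (\<omega> * real n) * real_of_int q"
  proof -
    have "real (nat r) = real i + real_of_int d - real_of_int q * real n"
      using r req by simp
    then show ?thesis by (simp only:) (simp add: ring_distribs)
  qed
  also have "\<dots> = (\<omega> * real_of_int d + (\<omega> * real i - \<omega> * real n / 2)) +
                   2 * pi * real_of_int (- (k * q))"
    by (simp add: wn)
  finally have "fourier_mode n \<omega> (nat r) =
      cis (\<omega> * real_of_int d + (\<omega> * real i - \<omega> * real n / 2)) *
      cis (2 * pi * real_of_int (- (k * q)))"
    by (simp only: mode cis_mult)
  also have "cis (2 * pi * real_of_int (- (k * q))) = 1"
    by (rule cis_multiple_2pi) (rule Ints_of_int)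
  finally show ?thesis by (simp add: mode r_def cis_mult)
qed

lemma fourier_eigenvalue_semi_lagrangian:
  assumes n: "n > 0" and w: "\<omega> \<in> frequencies n"
  shows "fourier_eigenvalue n (semi_lagrangian p n \<alpha> \<tau>) \<omega> =
         sl_symbol p (\<alpha> * \<tau> / mesh_width n) \<omega>"
proof -
  define c where "c = \<alpha> * \<tau> / mesh_width n"
  have eig: "semi_lagrangian p n \<alpha> \<tau> (fourier_mode n \<omega>) i = sl_symbol p c \<omega> * fourier_mode n \<omega> i" for i
  proof -
    have shift: "fourier_mode n \<omega> (nat ((int i - \<lfloor>c\<rfloor> + j) mod int n)) =
        cis (- \<omega> * real_of_int \<lfloor>c\<rfloor>) * cis (\<omega> * real_of_int j) * fourier_mode n \<omega> i" for j
      using fourier_mode_shift[OF n w, of i "j - \<lfloor>c\<rfloor>"]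
      by (simp add: cis_mult algebra_simps)
    show ?thesis
      by (simp add: semi_lagrangian_def Let_def c_def[symmetric] shift sl_symbol_def
          sum_distrib_left sum_distrib_right scaleR_conv_of_real mult_ac)
  qed
  have nz: "fourier_mode n \<omega> 0 \<noteq> 0" by (simp add: fourier_mode_def)
  have "fourier_eigenvalue n (semi_lagrangian p n \<alpha> \<tau>) \<omega> = sl_symbol p c \<omega>"
    unfolding fourier_eigenvalue_def
  proof (rule the_equality)
    fix z assume "\<forall>i<n. semi_lagrangian p n \<alpha> \<tau> (fourier_mode n \<omega>) i = z * fourier_mode n \<omega> i"
    with n have "sl_symbol p c \<omega> * fourier_mode n \<omega> 0 = z * fourier_mode n \<omega> 0"
      by (simp add: eig)
    with nz show "z = sl_symbol p c \<omega>" by simp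
  qed (simp add: eig)
  then show ?thesis by (simp add: c_def)
qed

definition Theta_low :: "nat \<Rightarrow> real set" where
  "Theta_low m = {- pi / real m ..< pi / real m}"

definition coarse_symbol :: "complex \<Rightarrow> real \<Rightarrow> complex" where
  "coarse_symbol z \<phi> = 1 - z * cis (- \<phi>)"

text \<open>Here \<open>\<Phi>\<close> and \<open>\<Psi>\<close> are the fine- and coarse-grid time-stepping operators. Where the
  denominator vanishes the quotient is \<open>0\<close> by convention, which can only lower a
  supremum of this quantity.\<close>

definition mgrit_spectral_radius ::
    "nat \<Rightarrow> nat \<Rightarrow> nat \<Rightarrow> ((nat \<Rightarrow> complex) \<Rightarrow> nat \<Rightarrow> complex) \<Rightarrow>
     ((nat \<Rightarrow> complex) \<Rightarrow> nat \<Rightarrow> complex) \<Rightarrow> real \<Rightarrow> real \<Rightarrow> real" where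
  "mgrit_spectral_radius m \<nu> n \<Phi> \<Psi> \<omega> \<theta> =
     (if \<omega> = 0 then 0 else
      let lam = fourier_eigenvalue n \<Phi> \<omega>;
          mu = fourier_eigenvalue n \<Psi> \<omega>;
          A = coarse_symbol mu (real m * \<theta>);
          A_ideal = coarse_symbol (lam ^ m) (real m * \<theta>)
      in cmod lam ^ (m * \<nu>) * cmod ((A - A_ideal) / A))"

text \<open>The maximum over all space-time modes, taken as a supremum in the extended reals
  because \<open>\<theta>\<close> ranges over a continuum.\<close>

definition max_mgrit_spectral_radius ::
    "nat \<Rightarrow> nat \<Rightarrow> nat \<Rightarrow> ((nat \<Rightarrow> complex) \<Rightarrow> nat \<Rightarrow> complex) \<Rightarrow>
     ((nat \<Rightarrow> complex) \<Rightarrow> nat \<Rightarrow> complex) \<Rightarrow> ereal" where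
  "max_mgrit_spectral_radius m \<nu> n \<Phi> \<Psi> =
     (SUP (\<omega>, \<theta>) \<in> frequencies n \<times> Theta_low m. ereal (mgrit_spectral_radius m \<nu> n \<Phi> \<Psi> \<omega> \<theta>))"

text \<open>This is \<open>f\<close> with index \<open>p + 1\<close>; the range of the product is the stencil.\<close>

definition f_poly :: "nat \<Rightarrow> real \<Rightarrow> real" where
  "f_poly p z = (\<Prod>q\<in>stencil p. real_of_int q + z) / fact (p + 1)"

definition rho_check :: "nat \<Rightarrow> nat \<Rightarrow> real \<Rightarrow> real" where
  "rho_check p m e = real m * (f_poly p e / f_poly p (frac (real m * e))) - 1"

definition Upsilon :: "nat \<Rightarrow> real set" where
  "Upsilon m = {0<..<1} - {e. frac (real m * e) = 0}"

end

theory Submission imports Defs begin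

text \<open>
  Why the bound holds. In the frame moving with the exact solution, the semi-Lagrangian symbol
  at CFL number \<open>c\<close> is the value, at the foot of the characteristic, of the polynomial
  interpolating a Fourier mode that equals \<open>1\<close> there. By the interpolation error formula it is
  \<open>1 - (\<i> \<omega>)\<^sup>p\<^sup>+\<^sup>1 f (frac c) + O(\<omega>\<^sup>p\<^sup>+\<^sup>2)\<close> (lemma \<open>symbol_expansion\<close>). As \<open>\<i>\<^sup>p\<^sup>+\<^sup>1\<close> is
  real, the leading error is dissipation. The fine operator, applied \<open>m\<close> times, and the
  coarse operator move a Fourier mode at the same speed and differ to leading order only in
  the amount of dissipation, \<open>m f (frac c)\<close> against \<open>f (frac (m c))\<close>. Now take the smoothest nonconstant mode
  \<open>\<omega> = 2 \<pi> / n\<close>, and choose the temporal frequency \<open>\<theta>\<close> so that the space-time mode travels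
  with the flow, \<open>m \<theta> = - \<omega> m c\<close> modulo \<open>2 \<pi>\<close>. For this characteristic mode the common
  transport factor cancels from
  numerator and denominator of the error symbol, and both are of size \<open>\<omega>\<^sup>p\<^sup>+\<^sup>1\<close>. After division
  by that power the quotient tends, with error \<open>O(\<omega>) = O(h)\<close>, to
  \<open>1 - m f (frac c) / f (frac (m c))\<close> (lemma \<open>aligned_radius_limit\<close>), whose modulus is at least
  \<open>rho_check\<close>. Relaxation multiplies by a power of the fine symbol, which is \<open>1 + O(\<omega>)\<close>;
  it has no effect on the limit, and so the bound is the same for every \<open>\<nu>\<close>.

  Why \<open>rho_check\<close> exceeds one. Up to a constant, \<open>f\<close> is
  \<open>N e = (\<Prod>j<k. (j + e) (j + 1 - e))\<close> with \<open>k = (p + 1) / 2\<close>, and \<open>m N e > 2 N (frac (m e))\<close> has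
  to be shown. Three properties of \<open>N\<close> suffice: it is symmetric about \<open>1 / 2\<close>, strictly
  increasing up to \<open>1 / 2\<close>, and \<open>N e / e\<close> is strictly decreasing, because pairing the factors
  differently gives \<open>N e = e (k - e) (\<Prod>j=1..<k. j\<^sup>2 - e\<^sup>2)\<close>. By symmetry let \<open>e \<le> 1 / 2\<close>. If
  \<open>e \<ge> 1 / m\<close>, then \<open>m N e \<ge> m N (1 / m) > 2 N (1 / 2)\<close>, which is the maximum of \<open>2 N\<close>
  (here \<open>m > 2\<close>, because \<open>m = 2\<close> would leave only \<open>e = 1 / 2\<close>, where \<open>m e\<close> is an integer). If
  \<open>2 / (3 m) < e < 1 / m\<close>, then \<open>m N e \<ge> 2 N (m e / 2)\<close>, and \<open>m e / 2 > 1 - m e\<close> says that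
  \<open>m e / 2\<close> is closer to \<open>1 / 2\<close> than \<open>m e\<close> is; the number \<open>2 / (3 m)\<close> is the solution
  of \<open>m e / 2 = 1 - m e\<close>.
\<close>

section \<open>The size of the error constant\<close>

text \<open>Up to sign and factorial this is \<open>f_poly p\<close> with \<open>p + 1 = 2 * k\<close>; the factors of the nodes
  \<open>j\<close> and \<open>- j - 1\<close> are taken together and made positive on the unit interval.\<close>

definition half_product :: "nat \<Rightarrow> real \<Rightarrow> real" where
  "half_product k e = (\<Prod>j<k. (real j + e) * (real j + 1 - e))"

lemma half_product_symmetric: "half_product k (1 - e) = half_product k e"
  unfolding half_product_def by (intro prod.cong) (auto simp: algebra_simps)

lemma half_product_pos: "0 < e \<Longrightarrow> e < 1 \<Longrightarrow> 0 < half_product k e"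
  unfolding half_product_def by (intro prod_pos) (simp add: add_nonneg_pos)

text \<open>Each factor is \<open>j (j + 1) + e (1 - e)\<close>, hence increasing in \<open>e (1 - e)\<close>.\<close>

lemma half_product_mono:
  assumes "0 < e" "e < e'" "e' \<le> 1 / 2" "k > 0"
  shows "half_product k e < half_product k e'"
proof -
  have "0 < (e' - e) * (1 - e - e')" using assms by (intro mult_pos_pos) auto
  then have y: "e * (1 - e) < e' * (1 - e')" by (simp add: algebra_simps)
  have *: "(real j + t) * (real j + 1 - t) = real j * (real j + 1) + t * (1 - t)" for j t
    by (simp add: algebra_simps)
  have "0 < e * (1 - e)" using assms by simp
  then show ?thesis
    unfolding half_product_def * using y assms
    by (intro prod_mono_strict[of 0]) (auto intro!: add_nonneg_pos simp: less_imp_le)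
qed

text \<open>Pairing \<open>j + e\<close> with \<open>j - e\<close> instead leaves \<open>e\<close> and \<open>k - e\<close> over. In this form the
  monotonicity of the quotient by \<open>e\<close> can be read off factor by factor.\<close>

lemma half_product_factor:
  "k > 0 \<Longrightarrow> half_product k e = e * ((\<Prod>j=1..<k. real j ^ 2 - e ^ 2) * (real k - e))"
proof (induction k rule: nat_induct_non_zero)
  case 1
  then show ?case by (simp add: half_product_def)
next
  case (Suc k)
  have "half_product (Suc k) e = half_product k e * ((real k + e) * (real k + 1 - e))"
    by (simp add: half_product_def)
  then show ?case using Suc by (simp add: power2_eq_square algebra_simps)
qed

lemma half_product_over_id_antimono:
  assumes "0 < e" "e < e'" "e' < 1" "k > 0"
  shows "half_product k e' / e' < half_product k e / e"
proof -
  have sq: "e ^ 2 \<le> e' ^ 2" "e' ^ 2 < 1"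
    using assms by (auto simp: power_mono abs_square_less_1)
  have one: "1 \<le> real j ^ 2" if "j \<in> {1..<k}" for j
    using that by (intro one_le_power) auto
  have "(\<Prod>j=1..<k. real j ^ 2 - e' ^ 2) \<le> (\<Prod>j=1..<k. real j ^ 2 - e ^ 2)"
  proof (rule prod_mono)
    fix j assume "j \<in> {1..<k}"
    from one[OF this] sq show "0 \<le> real j ^ 2 - e' ^ 2 \<and> real j ^ 2 - e' ^ 2 \<le> real j ^ 2 - e ^ 2"
      by linarith
  qed
  moreover have "0 < (\<Prod>j=1..<k. real j ^ 2 - e ^ 2)"
  proof (rule prod_pos)
    fix j assume "j \<in> {1..<k}"
    from one[OF this] sq show "0 < real j ^ 2 - e ^ 2" by linarith
  qed
  moreover have "real k - e' < real k - e" "0 \<le> real k - e'" using assms by auto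
  ultimately have "(\<Prod>j=1..<k. real j ^ 2 - e' ^ 2) * (real k - e')
      < (\<Prod>j=1..<k. real j ^ 2 - e ^ 2) * (real k - e)"
    by (intro le_less_trans[OF mult_right_mono mult_strict_left_mono]) auto
  then show ?thesis using assms by (simp add: half_product_factor)
qed

text \<open>The heart of the claim that \<open>rho_check\<close> exceeds one. The decrease of
  \<open>half_product k e / e\<close> turns the factor \<open>m\<close> into a larger argument: \<open>e\<close> is moved to
  \<open>m e / 2\<close> in the first case and from \<open>1 / m\<close> to \<open>1 / 2\<close> in the second.\<close>

lemma half_product_contraction:
  assumes m: "m \<ge> 2" and k: "k > 0" and e: "2 / (3 * real m) < e" "e \<le> 1 / 2"
    and fr: "frac (real m * e) \<noteq> 0"
  shows "2 * half_product k (frac (real m * e)) < real m * half_product k e"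
proof (cases "e < 1 / real m")
  case True
  have m0: "real m > 0" using m by simp
  have me: "2 / 3 < real m * e" "real m * e < 1"
    using e True m0 by (auto simp: divide_less_eq less_divide_eq mult_ac)
  have e0: "0 < e" using e m0 less_trans[of 0 "2 / (3 * real m)" e] by simp
  have "frac (real m * e) = real m * e" using me by (simp add: frac_eq)
  then have "2 * half_product k (frac (real m * e)) = 2 * half_product k (1 - real m * e)"
    by (simp add: half_product_symmetric)
  also have "\<dots> < 2 * half_product k (real m * e / 2)"
    using me k by (intro mult_strict_left_mono half_product_mono) linarith+
  also have "\<dots> \<le> real m * half_product k e"
    \<comment> \<open>For \<open>m = 2\<close> the arguments \<open>e\<close> and \<open>m e / 2\<close> coincide and both sides are equal.\<close>
  proof (cases "m = 2")
    case False
    then have "e < real m * e / 2" using m e0 by simp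
    then have "half_product k (real m * e / 2) / (real m * e / 2) < half_product k e / e"
      using me k e0 by (intro half_product_over_id_antimono) auto
    then show ?thesis using e0 m0 by (simp add: field_simps)
  qed simp
  finally show ?thesis .
next
  case False
  let ?x = "frac (real m * e)"
  have m0: "real m > 0" using m by simp
  \<comment> \<open>For \<open>m = 2\<close> only \<open>e = 1 / 2\<close> would be left, where the coarse CFL number is an integer.\<close>
  have "m \<noteq> 2"
  proof
    assume [simp]: "m = 2"
    then have "real m * e = 1" using False e by simp
    then show False using fr by simp
  qed
  then have m2: "1 / real m < 1 / 2" using m by (simp add: field_simps)
  have mono: "half_product k s \<le> half_product k t" if "0 < s" "s \<le> t" "t \<le> 1 / 2" for s t
    using half_product_mono[of s t k] that k by (cases "s = t") auto
  have x: "0 < ?x" "?x < 1" using fr by (auto simp: frac_lt_1)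
  have "half_product k ?x \<le> half_product k (1 / 2)"
    using mono[of ?x "1/2"] mono[of "1 - ?x" "1/2"] x
    by (cases "?x \<le> 1 / 2") (auto simp: half_product_symmetric)
  moreover have "half_product k (1 / 2) / (1 / 2) < half_product k (1 / real m) / (1 / real m)"
    using m2 m0 k by (intro half_product_over_id_antimono) auto
  then have "2 * half_product k (1 / 2) < real m * half_product k (1 / real m)"
    by (simp add: mult.commute)
  moreover have "real m * half_product k (1 / real m) \<le> real m * half_product k e"
    using mono[of "1 / real m" e] m0 False e by (intro mult_left_mono) auto
  ultimately show ?thesis by linarith
qed

lemma stencil_odd:
  assumes "odd p"
  obtains k where "p + 1 = 2 * k" "k > 0" "stencil p = {- int k..int k - 1}"
proof -
  obtain l where "p = 2 * l + 1" using assms by (elim oddE)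
  then show ?thesis by (intro that[of "Suc l"]) (auto simp: stencil_def)
qed

lemma card_stencil: "odd p \<Longrightarrow> card (stencil p) = p + 1"
  by (erule stencil_odd) simp

lemma stencil_prod_split:
  fixes g :: "int \<Rightarrow> real"
  shows "(\<Prod>q\<in>{- int k..int k - 1}. g q) = (\<Prod>j<k. g (- int j - 1) * g (int j))"
proof (induction k)
  case (Suc k)
  have "{- int (Suc k)..int (Suc k) - 1} = insert (- int k - 1) (insert (int k) {- int k..int k - 1})"
    by auto
  then show ?case using Suc by (simp add: mult_ac)
qed simp

lemma f_poly_half_product:
  assumes "p + 1 = 2 * k" "stencil p = {- int k..int k - 1}"
  shows "f_poly p z = (- 1) ^ k * half_product k z / fact (p + 1)"
proof -
  have "(\<Prod>q\<in>stencil p. real_of_int q + z) = (\<Prod>j<k. - 1 * ((real j + z) * (real j + 1 - z)))"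
    unfolding assms stencil_prod_split by (intro prod.cong) (auto simp: algebra_simps)
  then show ?thesis unfolding f_poly_def half_product_def prod.distrib by simp
qed

lemma f_poly_nonzero: "odd p \<Longrightarrow> 0 < e \<Longrightarrow> e < 1 \<Longrightarrow> f_poly p e \<noteq> 0"
  using half_product_pos[of e] by (elim stencil_odd) (simp add: f_poly_half_product less_imp_neq[symmetric])

lemma rho_check_gt_1:
  assumes p: "odd p" and m: "m \<ge> 2"
    and e: "e \<in> Upsilon m \<inter> {2 / (3 * real m) <..< 1 - 2 / (3 * real m)}"
  shows "rho_check p m e > 1"
proof -
  obtain k where k: "p + 1 = 2 * k" "k > 0" "stencil p = {- int k..int k - 1}"
    using stencil_odd[OF p] .
  let ?x = "frac (real m * e)"
  have fr: "?x \<noteq> 0" and eb: "2 / (3 * real m) < e" "e < 1 - 2 / (3 * real m)"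
    using e by (auto simp: Upsilon_def)
  have x: "0 < ?x" "?x < 1" using fr by (auto simp: frac_lt_1)
  have "2 * half_product k ?x < real m * half_product k e"
  proof (cases "e \<le> 1 / 2")
    case True
    then show ?thesis using half_product_contraction m k eb fr by blast
  next
    case False
    have "frac (real m * (1 - e)) = frac (- (real m * e))"
      using frac_add_int_left[of "real m" "- (real m * e)"] by (simp add: right_diff_distrib)
    also have "\<dots> = 1 - ?x" using fr by (simp add: frac_neg)
    finally have f: "frac (real m * (1 - e)) = 1 - ?x" .
    have "2 * half_product k (frac (real m * (1 - e))) < real m * half_product k (1 - e)"
    proof (rule half_product_contraction[OF m k(2)])
      show "2 / (3 * real m) < 1 - e" "1 - e \<le> 1 / 2" using eb False by linarith+
      show "frac (real m * (1 - e)) \<noteq> 0" using x f by linarith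
    qed
    then show ?thesis by (simp add: f half_product_symmetric)
  qed
  moreover have "f_poly p e / f_poly p ?x = half_product k e / half_product k ?x"
    using k by (simp add: f_poly_half_product)
  moreover have "2 < real m * (half_product k e / half_product k ?x)"
    using calculation(1) pos_less_divide_eq[OF half_product_pos[OF x]]
    unfolding times_divide_eq_right by blast
  ultimately have "2 < real m * (f_poly p e / f_poly p ?x)" by (simp only:)
  then show ?thesis by (simp only: rho_check_def)
qed

section \<open>Expansion of the symbol at low frequency\<close>

text \<open>There are \<open>p + 1\<close> nodes, so interpolation is exact up to degree \<open>p\<close>; in degree \<open>p + 1\<close> the
  difference between \<open>q\<close> and its interpolant vanishes at all nodes and has the same top coefficient
  as \<open>q\<close>, hence is that multiple of the monic node polynomial. Degree \<open>p + 1\<close> is exactly what the first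
  error term requires.\<close>

lemma lagrange_interpolation_error:
  fixes q :: "real poly"
  assumes p: "odd p" and q: "degree q \<le> p + 1"
  shows "(\<Sum>j\<in>stencil p. lagrange_basis p j x * poly q (real_of_int j))
       = poly q x - coeff q (p + 1) * (\<Prod>k\<in>stencil p. x - real_of_int k)"
proof -
  define L where "L j = (\<Prod>k\<in>stencil p - {j}.
      smult (1 / (real_of_int j - real_of_int k)) [:- real_of_int k, 1:])" for j :: int
  define W where "W = (\<Prod>k\<in>stencil p. [:- real_of_int k, 1:])"
  define P where "P = (\<Sum>j\<in>stencil p. smult (poly q (real_of_int j)) (L j))"
  have fin: "finite (stencil p)" by (simp add: stencil_def)
  have poly_L: "poly (L j) y = lagrange_basis p j y" for j y
    by (simp add: L_def lagrange_basis_def poly_prod diff_divide_distrib)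
  have poly_W: "poly W y = (\<Prod>k\<in>stencil p. y - real_of_int k)" for y
    by (simp add: W_def poly_prod)
  have "degree (L j) \<le> p" if "j \<in> stencil p" for j
  proof -
    have "degree (L j) \<le> (\<Sum>k\<in>stencil p - {j}. 1)"
      unfolding L_def using fin
      by (intro order_trans[OF degree_prod_sum_le] sum_mono) auto
    also have "\<dots> = p" using fin that card_stencil[OF p] by simp
    finally show ?thesis .
  qed
  then have deg_P: "degree P \<le> p"
    unfolding P_def using fin
    by (intro degree_sum_le) (auto intro: order_trans[OF degree_smult_le])
  have deg_W: "degree W = p + 1"
    unfolding W_def using card_stencil[OF p] by (subst degree_prod_sum_eq) auto
  have "lead_coeff W = 1" by (simp add: W_def lead_coeff_prod)
  then have monic_W: "coeff W (p + 1) = 1" by (simp add: deg_W)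
  have delta: "lagrange_basis p j (real_of_int i) = (if i = j then 1 else 0)"
    if "i \<in> stencil p" "j \<in> stencil p" for i j
    using that fin by (auto simp: lagrange_basis_def)
  have "P + smult (coeff q (p + 1)) W = q"
  proof (rule poly_eqI_degree_lead_coeff[where A = "real_of_int ` stencil p" and n = "p + 1"])
    show "coeff (P + smult (coeff q (p + 1)) W) (p + 1) = coeff q (p + 1)"
      using deg_P monic_W by (simp add: coeff_eq_0)
    show "p + 1 \<le> card (real_of_int ` stencil p)"
      using card_stencil[OF p] by (subst card_image) (auto simp: inj_on_def)
    show "degree (P + smult (coeff q (p + 1)) W) \<le> p + 1"
      using deg_P deg_W by (intro degree_add_le order_trans[OF degree_smult_le]) auto
    show "degree q \<le> p + 1" by fact
    fix z assume "z \<in> real_of_int ` stencil p"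
    then obtain i where i: "i \<in> stencil p" "z = real_of_int i" by auto
    have "poly W z = 0" using i fin by (auto simp: poly_W)
    moreover have "poly P z = (\<Sum>j\<in>stencil p. if i = j then poly q (real_of_int j) else 0)"
      unfolding P_def poly_sum i by (intro sum.cong) (auto simp: poly_L delta i)
    ultimately show "poly (P + smult (coeff q (p + 1)) W) z = poly q z"
      using i fin by simp
  qed
  then have "poly q x = poly P x + coeff q (p + 1) * poly W x"
    by (metis poly_add poly_smult)
  then show ?thesis by (simp add: P_def poly_sum poly_L poly_W mult.commute)
qed

text \<open>The interpolation error formula at the foot \<open>- e\<close> of the characteristic, for the powers that
  occur in the Taylor expansion of a Fourier mode about that point. As \<open>p + 1\<close> is even, reversing
  the signs of all factors of the node polynomial does not change it.\<close>

lemma lagrange_basis_moment: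
  assumes p: "odd p" and r: "r \<le> p + 1"
  shows "(\<Sum>j\<in>stencil p. lagrange_basis p j (- e) * (real_of_int j + e) ^ r)
       = (if r = 0 then 1 else if r = p + 1 then - fact (p + 1) * f_poly p e else 0)"
proof -
  let ?q = "[:e, 1:] ^ r"
  have deg: "degree ?q = r" by (simp add: degree_power_eq)
  have "lead_coeff ?q = 1" by (simp add: lead_coeff_power)
  then have co: "coeff ?q (p + 1) = (if r = p + 1 then 1 else 0)"
    using r by (auto simp: deg coeff_eq_0)
  have "(\<Prod>k\<in>stencil p. - e - real_of_int k) = (\<Prod>k\<in>stencil p. - 1 * (real_of_int k + e))"
    by (intro prod.cong) auto
  also have "\<dots> = (\<Prod>k\<in>stencil p. real_of_int k + e)"
    using card_stencil[OF p] p unfolding prod.distrib by simp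
  also have "\<dots> = fact (p + 1) * f_poly p e" by (simp add: f_poly_def)
  finally have W: "(\<Prod>k\<in>stencil p. - e - real_of_int k) = fact (p + 1) * f_poly p e" .
  show ?thesis
    using lagrange_interpolation_error[OF p, of ?q "- e"] r co W
    by (auto simp: deg add.commute zero_power)
qed

text \<open>Passing to the moving frame removes the integer shift: the Lagrange weights now act on a
  mode that equals \<open>1\<close> at the foot \<open>- frac c\<close> of the characteristic.\<close>

lemma frame_symbol:
  "cis (w * c) * sl_symbol p c w
     = (\<Sum>j\<in>stencil p. of_real (lagrange_basis p j (- frac c)) * cis (w * (real_of_int j + frac c)))"
proof -
  have "cis (w * c) * (cis (- w * real_of_int \<lfloor>c\<rfloor>) * cis (w * real_of_int j))
      = cis (w * (real_of_int j + frac c))" for j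
    by (simp add: cis_mult frac_def algebra_simps)
  then show ?thesis
    unfolding sl_symbol_def sum_distrib_left
    by (intro sum.cong refl) (metis (no_types, opaque_lifting) mult.left_commute)
qed

text \<open>Taylor expansion of each mode value to degree \<open>p + 1\<close>, followed by the moment identities:
  degree \<open>0\<close> contributes \<open>1\<close>, the degrees from \<open>1\<close> to \<open>p\<close> cancel, and degree \<open>p + 1\<close> leaves the
  dissipation term. The estimate holds uniformly in \<open>w\<close>, hence along any filter.\<close>

lemma symbol_expansion:
  assumes p: "odd p"
  shows "(\<lambda>w. cis (w * c) * sl_symbol p c w - (1 - \<i> ^ (p + 1) * of_real (f_poly p (frac c)) * of_real w ^ (p + 1)))
           \<in> O[F](\<lambda>w. of_real w ^ (p + 2))"
proof -
  define e where "e = frac c"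
  define l where "l j = lagrange_basis p j (- e)" for j
  define x where "x j w = \<i> * of_real (w * (real_of_int j + e))" for j w
  define T where "T j w = (\<Sum>r\<le>p + 1. x j w ^ r / fact r)" for j w
  have main: "(\<Sum>j\<in>stencil p. of_real (l j) * T j w)
      = 1 - \<i> ^ (p + 1) * of_real (f_poly p e) * of_real w ^ (p + 1)" for w
  proof -
    have "(\<Sum>j\<in>stencil p. of_real (l j) * T j w)
        = (\<Sum>r\<le>p + 1. \<Sum>j\<in>stencil p. of_real (l j) * (x j w ^ r / fact r))"
      unfolding T_def sum_distrib_left by (rule sum.swap)
    also have "\<dots> = (\<Sum>r\<le>p + 1. (\<i> * of_real w) ^ r / fact r *
        of_real (\<Sum>j\<in>stencil p. l j * (real_of_int j + e) ^ r))"
      by (intro sum.cong refl) (simp add: x_def sum_distrib_left power_mult_distrib mult_ac)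
    also have "\<dots> = (\<Sum>r\<le>p + 1. (if r = 0 then 1 else 0) +
        (if r = p + 1 then - ((\<i> * of_real w) ^ (p + 1) * of_real (f_poly p e)) else 0))"
      unfolding l_def by (intro sum.cong refl) (auto simp: lagrange_basis_moment[OF p] simp del: fact_Suc)
    also have "\<dots> = 1 - \<i> ^ (p + 1) * of_real (f_poly p e) * of_real w ^ (p + 1)"
      unfolding sum.distrib by (simp add: power_mult_distrib mult_ac)
    finally show ?thesis .
  qed
  have "(\<lambda>w. cis (w * (real_of_int j + e)) - T j w) \<in> O[F](\<lambda>w. of_real w ^ (p + 2))" for j
  proof (rule bigoI[where c = "\<bar>real_of_int j + e\<bar> ^ (p + 2) / fact (p + 1)"], intro always_eventually allI)
    fix w
    show "cmod (cis (w * (real_of_int j + e)) - T j w)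
        \<le> \<bar>real_of_int j + e\<bar> ^ (p + 2) / fact (p + 1) * cmod (of_real w ^ (p + 2))"
      using Taylor_exp[of "x j w" "p + 1"]
      by (simp add: T_def x_def cis_conv_exp norm_mult norm_power abs_mult power_mult_distrib
          mult_ac del: fact_Suc power_Suc of_real_mult of_real_add)
  qed
  then have "(\<lambda>w. \<Sum>j\<in>stencil p. of_real (l j) * (cis (w * (real_of_int j + e)) - T j w))
      \<in> O[F](\<lambda>w. of_real w ^ (p + 2))"
    by (intro big_sum_in_bigo) simp
  then show ?thesis
    unfolding frame_symbol main[unfolded e_def, symmetric]
    by (simp add: l_def e_def right_diff_distrib sum_subtractf)
qed

section \<open>Approximation up to a bounded multiple of a gauge\<close>

text \<open>The relation \<open>f = a + O(g)\<close> is compatible with products, powers and quotients. These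
  rules carry the rate \<open>O(h)\<close> through the error symbol, which limit theorems alone would lose.\<close>

lemma bigo_approx_mult:
  fixes f f' g :: "'a \<Rightarrow> 'b::real_normed_field"
  assumes f: "(\<lambda>x. f x - a) \<in> O[F](g)" and f': "(\<lambda>x. f' x - a') \<in> O[F](g)"
    and g: "g \<in> O[F](\<lambda>_. 1)"
  shows "(\<lambda>x. f x * f' x - a * a') \<in> O[F](g)"
proof -
  have "(\<lambda>x. (f' x - a') + a') \<in> O[F](\<lambda>_. 1)"
    by (intro sum_in_bigo landau_o.big.trans[OF f' g] bigo_const)
  from landau_o.big.mult[OF f this]
  have "(\<lambda>x. (f x - a) * f' x) \<in> O[F](g)" by simp
  moreover have "(\<lambda>x. a * (f' x - a')) \<in> O[F](g)"
    using landau_o.big.mult[OF bigo_const[of a] f'] by simp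
  ultimately have "(\<lambda>x. (f x - a) * f' x + a * (f' x - a')) \<in> O[F](g)"
    by (rule sum_in_bigo)
  then show ?thesis by (simp add: algebra_simps)
qed

lemma bigo_approx_power:
  fixes f g :: "'a \<Rightarrow> 'b::real_normed_field"
  assumes "(\<lambda>x. f x - a) \<in> O[F](g)" "g \<in> O[F](\<lambda>_. 1)"
  shows "(\<lambda>x. f x ^ n - a ^ n) \<in> O[F](g)"
  by (induction n) (use assms in \<open>auto intro: bigo_approx_mult\<close>)

lemma bigo_approx_divide:
  fixes f f' g :: "'a \<Rightarrow> 'b::real_normed_field"
  assumes f: "(\<lambda>x. f x - a) \<in> O[F](g)" and f': "(\<lambda>x. f' x - a') \<in> O[F](g)"
    and g: "(g \<longlongrightarrow> 0) F" and a': "a' \<noteq> 0"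
  shows "(\<lambda>x. f x / f' x - a / a') \<in> O[F](g)"
proof -
  have g1: "g \<in> O[F](\<lambda>_. 1)" using g by (intro bigoI_tendsto) auto
  have "(\<lambda>x. f' x - a') \<in> o[F](\<lambda>_. 1)"
    using g by (intro landau_o.big_small_trans[OF f'] smalloI_tendsto) auto
  then have "((\<lambda>x. f' x - a') \<longlongrightarrow> 0) F" by (auto dest: smalloD_tendsto)
  then have lim: "(f' \<longlongrightarrow> a') F" by (simp add: LIM_zero_iff)
  then have "((\<lambda>x. inverse (f' x)) \<longlongrightarrow> inverse a') F" using a' by (rule tendsto_inverse)
  then have inv: "(\<lambda>x. - inverse a' * inverse (f' x)) \<in> O[F](\<lambda>_. 1)"
    by (intro bigoI_tendsto[where c = "- inverse a' * inverse a'"]) (auto intro: tendsto_mult_left tendsto_minus)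
  have "(\<lambda>x. (f' x - a') * (- inverse a' * inverse (f' x))) \<in> O[F](g)"
    using landau_o.big.mult[OF f' inv] by simp
  moreover have "eventually (\<lambda>x. f' x \<noteq> 0) F"
    using lim a' by (rule tendsto_imp_eventually_ne)
  then have "eventually (\<lambda>x. (f' x - a') * (- inverse a' * inverse (f' x)) = inverse (f' x) - inverse a') F"
    by eventually_elim (use a' in \<open>simp add: field_simps\<close>)
  ultimately have "(\<lambda>x. inverse (f' x) - inverse a') \<in> O[F](g)"
    by (rule landau_o.big.in_cong[THEN iffD1, rotated])
  from bigo_approx_mult[OF f this g1] show ?thesis by (simp add: divide_inverse)
qed

lemma of_real_tendsto_0: "((\<lambda>w. of_real w :: complex) \<longlongrightarrow> 0) (at (0::real))"
  using tendsto_of_real[OF tendsto_ident_at, of 0 UNIV] by simp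

section \<open>The characteristic space-time mode\<close>

definition moving_symbol :: "nat \<Rightarrow> real \<Rightarrow> real \<Rightarrow> complex" where
  "moving_symbol p c w = cis (w * c) * sl_symbol p c w"

text \<open>The damping of one step, scaled by the order at which it enters. Its limit at frequency zero
  is finite and, for a CFL number that is not an integer, nonzero, so quotients of it are harmless.\<close>

definition dissipation :: "nat \<Rightarrow> real \<Rightarrow> real \<Rightarrow> complex" where
  "dissipation p c w = (1 - moving_symbol p c w) / of_real w ^ (p + 1)"

lemma dissipation_limit:
  assumes "odd p"
  shows "(\<lambda>w. dissipation p c w - \<i> ^ (p + 1) * of_real (f_poly p (frac c))) \<in> O[at 0](of_real)"
proof -
  let ?b = "\<i> ^ (p + 1) * of_real (f_poly p (frac c)) :: complex"
  have "(\<lambda>w. (moving_symbol p c w - (1 - ?b * of_real w ^ (p + 1))) * (- 1 / of_real w ^ (p + 1)))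
      \<in> O[at 0](\<lambda>w. of_real w ^ (p + 2) * (1 / of_real w ^ (p + 1)))"
    using symbol_expansion[OF assms, of c "at 0"]
    by (intro landau_o.big.mult) (simp_all add: moving_symbol_def)
  moreover have "eventually (\<lambda>w. (moving_symbol p c w - (1 - ?b * of_real w ^ (p + 1))) * (- 1 / of_real w ^ (p + 1))
      = dissipation p c w - ?b) (at (0::real))"
    using eventually_neq_at_within[of 0]
    by eventually_elim (simp add: dissipation_def field_simps)
  ultimately have "(\<lambda>w. dissipation p c w - ?b) \<in> O[at 0](\<lambda>w. of_real w ^ (p + 2) * (1 / of_real w ^ (p + 1)))"
    by (rule landau_o.big.in_cong[THEN iffD1, rotated])
  also have "eventually (\<lambda>w. of_real w ^ (p + 2) * (1 / of_real w ^ (p + 1)) = (of_real w :: complex)) (at (0::real))"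
    using eventually_neq_at_within[of 0]
    by eventually_elim (simp add: field_simps)
  then have "O[at 0](\<lambda>w. of_real w ^ (p + 2) * (1 / of_real w ^ (p + 1))) = O[at (0::real)](of_real :: real \<Rightarrow> complex)"
    by (rule landau_o.big.cong)
  finally show ?thesis .
qed

lemma moving_symbol_limit:
  assumes "odd p"
  shows "(\<lambda>w. moving_symbol p c w - 1) \<in> O[at 0](of_real)"
proof -
  let ?b = "\<i> ^ (p + 1) * of_real (f_poly p (frac c)) :: complex"
  have "(\<lambda>w. (dissipation p c w - ?b) + ?b) \<in> O[at 0](\<lambda>_. 1)"
    by (intro sum_in_bigo landau_o.big.trans[OF dissipation_limit[OF assms]] bigo_const bigoI_tendsto)
      (use of_real_tendsto_0 in auto)
  then have D: "(\<lambda>w. dissipation p c w) \<in> O[at 0](\<lambda>_. 1 :: complex)" by simp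
  have "((\<lambda>w. - (of_real w ^ p) :: complex) \<longlongrightarrow> - (0 ^ p)) (at (0::real))"
    by (intro tendsto_intros of_real_tendsto_0)
  then have "(\<lambda>w. - (of_real w ^ p) :: complex) \<in> O[at (0::real)](\<lambda>_. 1)"
    by (intro bigoI_tendsto) auto
  from landau_o.big.mult[OF D landau_o.big.mult[OF this landau_o.big_refl[of of_real]]]
  have "(\<lambda>w. dissipation p c w * (- (of_real w ^ p) * of_real w)) \<in> O[at 0](of_real)" by simp
  moreover have "eventually (\<lambda>w. dissipation p c w * (- (of_real w ^ p) * of_real w) = moving_symbol p c w - 1) (at (0::real))"
    using eventually_neq_at_within[of 0]
    by eventually_elim (simp add: dissipation_def field_simps)
  ultimately show ?thesis by (rule landau_o.big.in_cong[THEN iffD1, rotated])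
qed

text \<open>Up to a phase, the error symbol at the temporal frequency with \<open>m \<theta> = - w m c\<close> modulo \<open>2 \<pi>\<close>. For it
  \<open>cis (- m \<theta>) = cis (w m c)\<close> is exactly the factor that moves \<open>\<lambda>\<^sup>m\<close> and \<open>\<mu>\<close> to the moving
  frame. The modulus is the spectral radius of this mode, by lemma \<open>aligned_radius_le_max\<close> a
  lower bound for the maximum.\<close>

definition aligned_radius :: "nat \<Rightarrow> nat \<Rightarrow> nat \<Rightarrow> real \<Rightarrow> real \<Rightarrow> complex" where
  "aligned_radius p m \<nu> c w = moving_symbol p c w ^ (m * \<nu>) *
     ((moving_symbol p c w ^ m - moving_symbol p (real m * c) w) / (1 - moving_symbol p (real m * c) w))"

text \<open>Dividing numerator and denominator by \<open>w\<^sup>p\<^sup>+\<^sup>1\<close> expresses the quotient by the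
  dissipations alone; telescoping \<open>1 - E\<^sup>m = (1 - E) (\<Sum>k<m. E\<^sup>k)\<close> produces the factor \<open>m\<close>.\<close>

lemma aligned_radius_limit:
  assumes p: "odd p" and mc: "real m * c \<notin> \<int>"
  shows "(\<lambda>w. aligned_radius p m \<nu> c w - (- of_real (rho_check p m (frac c)))) \<in> O[at 0](of_real)"
proof -
  let ?E = "moving_symbol p c" and ?E' = "moving_symbol p (real m * c)"
  let ?D = "dissipation p c" and ?D' = "dissipation p (real m * c)"
  let ?b = "\<i> ^ (p + 1) * of_real (f_poly p (frac c)) :: complex"
  let ?b' = "\<i> ^ (p + 1) * of_real (f_poly p (frac (real m * c))) :: complex"
  have id1: "(\<lambda>w. of_real w :: complex) \<in> O[at (0::real)](\<lambda>_. 1)"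
    using of_real_tendsto_0 by (intro bigoI_tendsto) auto
  have nz: "f_poly p (frac (real m * c)) \<noteq> 0"
    using mc p by (intro f_poly_nonzero) (auto simp: frac_lt_1)
  have E: "(\<lambda>w. ?E w - 1) \<in> O[at 0](of_real)" by (rule moving_symbol_limit[OF p])
  have pow: "(\<lambda>w. ?E w ^ k - 1) \<in> O[at 0](of_real)" for k
    using bigo_approx_power[OF E id1, of k] by simp
  have S: "(\<lambda>w. (\<Sum>k<m. ?E w ^ k) - of_nat m) \<in> O[at 0](of_real)"
  proof -
    have "(\<lambda>w. \<Sum>k<m. ?E w ^ k - 1) \<in> O[at 0](of_real)"
      using pow by (intro big_sum_in_bigo)
    then show ?thesis by (simp add: sum_subtractf)
  qed
  have num: "(\<lambda>w. (?D' w - ?D w * (\<Sum>k<m. ?E w ^ k)) - (?b' - ?b * of_nat m)) \<in> O[at 0](of_real)"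
  proof -
    have "(\<lambda>w. (?D' w - ?b') - (?D w * (\<Sum>k<m. ?E w ^ k) - ?b * of_nat m)) \<in> O[at 0](of_real)"
      by (intro sum_in_bigo bigo_approx_mult dissipation_limit p S id1)
    then show ?thesis by (simp add: algebra_simps)
  qed
  have "(\<lambda>w. ?E w ^ (m * \<nu>) * ((?D' w - ?D w * (\<Sum>k<m. ?E w ^ k)) / ?D' w) - 1 * ((?b' - ?b * of_nat m) / ?b'))
      \<in> O[at 0](of_real)"
    using nz by (intro bigo_approx_mult pow bigo_approx_divide num dissipation_limit p of_real_tendsto_0 id1) auto
  moreover have "1 * ((?b' - ?b * of_nat m) / ?b') = - of_real (rho_check p m (frac c))"
  proof -
    have "real m * c = real_of_int (int m * \<lfloor>c\<rfloor>) + real m * frac c"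
      by (simp add: frac_def right_diff_distrib)
    then have "frac (real m * c) = frac (real m * frac c)"
      by (metis frac_add_int_left Ints_of_int)
    then show ?thesis using nz by (simp add: rho_check_def diff_divide_distrib)
  qed
  moreover have "eventually (\<lambda>w. ?E w ^ (m * \<nu>) * ((?D' w - ?D w * (\<Sum>k<m. ?E w ^ k)) / ?D' w)
      = aligned_radius p m \<nu> c w) (at (0::real))"
    using eventually_neq_at_within[of 0]
  proof eventually_elim
    case (elim w)
    have "(1 - ?E w) * (\<Sum>k<m. ?E w ^ k) = 1 - ?E w ^ m" by (simp only: one_diff_power_eq)
    then have "?D w * (\<Sum>k<m. ?E w ^ k) = (1 - ?E w ^ m) / of_real w ^ (p + 1)"
      by (simp only: dissipation_def times_divide_eq_left)
    then have "?D' w - ?D w * (\<Sum>k<m. ?E w ^ k) = ((1 - ?E' w) - (1 - ?E w ^ m)) / of_real w ^ (p + 1)"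
      by (simp only: dissipation_def diff_divide_distrib)
    then have "?D' w - ?D w * (\<Sum>k<m. ?E w ^ k) = (?E w ^ m - ?E' w) / of_real w ^ (p + 1)"
      by simp
    then show ?case using elim by (simp add: aligned_radius_def dissipation_def)
  qed
  then have "eventually (\<lambda>w. ?E w ^ (m * \<nu>) * ((?D' w - ?D w * (\<Sum>k<m. ?E w ^ k)) / ?D' w)
        - 1 * ((?b' - ?b * of_nat m) / ?b')
      = aligned_radius p m \<nu> c w - (- of_real (rho_check p m (frac c)))) (at (0::real))"
    by eventually_elim (simp only: calculation(2))
  from landau_o.big.in_cong[THEN iffD1, OF this calculation(1)] show ?thesis .
qed

lemma aligned_theta_exists:
  assumes "m > 0"
  obtains t where "t \<in> Theta_low m" "cis (- (real m * t)) = cis x"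
proof -
  define k where "k = \<lfloor>(pi - x) / (2 * pi)\<rfloor>"
  define y where "y = - x - 2 * pi * of_int k"
  have "of_int k \<le> (pi - x) / (2 * pi)" "(pi - x) / (2 * pi) < of_int k + 1"
    unfolding k_def by linarith+
  then have y: "- pi \<le> y" "y < pi"
    by (auto simp: y_def field_simps)
  have "- y = x + 2 * pi * of_int k" by (simp add: y_def)
  then have "cis (- y) = cis x * cis (2 * pi * of_int k)" by (simp only: cis_mult)
  also have "cis (2 * pi * of_int k) = 1" by (rule cis_multiple_2pi) auto
  finally have "cis (- y) = cis x" by simp
  moreover have "y / real m \<in> Theta_low m"
    using y assms divide_right_mono[of "- pi" y "real m"]
    by (auto simp: Theta_low_def divide_strict_right_mono)
  ultimately show ?thesis using assms by (intro that[of "y / real m"]) auto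
qed

text \<open>The smallest positive frequency \<open>2 \<pi> / n\<close> on the mesh, paired with the aligned temporal
  frequency, is one of the modes over which the maximum is taken. The bound \<open>n > 2\<close> keeps this
  frequency below \<open>\<pi>\<close>.\<close>

lemma aligned_radius_le_max:
  assumes m: "m > 0" and n: "n > 2" and c: "\<alpha> * \<delta>t / mesh_width n = c"
  shows "ereal (cmod (aligned_radius p m \<nu> c (2 * pi / real n)))
    \<le> max_mgrit_spectral_radius m \<nu> n (semi_lagrangian p n \<alpha> \<delta>t) (semi_lagrangian p n \<alpha> (real m * \<delta>t))"
proof -
  define w where "w = 2 * pi / real n"
  have "0 < w" "w < pi" using n by (simp_all add: w_def divide_less_eq)
  moreover have "w = 2 * pi * real_of_int 1 / real n" by (simp add: w_def)
  moreover have "- pi \<le> w" using \<open>0 < w\<close> pi_gt_zero by linarith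
  ultimately have w: "w \<in> frequencies n" "w \<noteq> 0"
    unfolding frequencies_def atLeastLessThan_iff mem_Collect_eq by blast+
  have "\<alpha> * (real m * \<delta>t) / mesh_width n = real m * c" by (simp add: c[symmetric])
  then have lam: "fourier_eigenvalue n (semi_lagrangian p n \<alpha> \<delta>t) w = sl_symbol p c w"
    and mu: "fourier_eigenvalue n (semi_lagrangian p n \<alpha> (real m * \<delta>t)) w = sl_symbol p (real m * c) w"
    using n w c by (simp_all add: fourier_eigenvalue_semi_lagrangian)
  obtain t where t: "t \<in> Theta_low m" "cis (- (real m * t)) = cis (w * (real m * c))"
    using aligned_theta_exists[OF m] by blast
  have pow: "moving_symbol p c w ^ m = sl_symbol p c w ^ m * cis (w * (real m * c))"
  proof -
    have "cis (w * (real m * c)) = cis (w * c) ^ m" by (simp only: Complex.DeMoivre mult.left_commute)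
    then show ?thesis by (simp add: moving_symbol_def power_mult_distrib)
  qed
  have mov: "moving_symbol p (real m * c) w = sl_symbol p (real m * c) w * cis (w * (real m * c))"
    by (simp add: moving_symbol_def)
  have "cmod (moving_symbol p c w) = cmod (sl_symbol p c w)"
    by (simp add: moving_symbol_def norm_mult)
  then have "mgrit_spectral_radius m \<nu> n (semi_lagrangian p n \<alpha> \<delta>t) (semi_lagrangian p n \<alpha> (real m * \<delta>t)) w t
      = cmod (aligned_radius p m \<nu> c w)"
    using w(2) unfolding mgrit_spectral_radius_def aligned_radius_def lam mu coarse_symbol_def t(2) Let_def pow mov
    by (simp add: norm_mult norm_power norm_divide)
  then show ?thesis
    unfolding max_mgrit_spectral_radius_def w_def[symmetric]
    using w(1) t(1) by (intro SUP_upper2[of "(w, t)"]) auto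
qed

theorem theorem5:
  fixes p m :: nat
  assumes "odd p" and "m \<ge> 2"
  shows "(\<forall>(\<nu>::nat) (c::real). c > 0 \<and> c \<notin> \<int> \<and> real m * c \<notin> \<int> \<longrightarrow>
            (\<exists>g :: nat \<Rightarrow> real. g \<in> O(mesh_width) \<and>
              (\<forall>\<^sub>F n in sequentially. \<forall>\<alpha> \<delta>t :: real.
                 \<alpha> > 0 \<and> \<delta>t > 0 \<and> \<alpha> * \<delta>t / mesh_width n = c \<longrightarrow>
                 max_mgrit_spectral_radius m \<nu> n
                   (semi_lagrangian p n \<alpha> \<delta>t) (semi_lagrangian p n \<alpha> (real m * \<delta>t))
                 \<ge> ereal (rho_check p m (frac c) * (1 + g n)))))
       \<and> (\<forall>e \<in> Upsilon m \<inter> {2 / (3 * real m) <..< 1 - 2 / (3 * real m)}. rho_check p m e > 1)"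
proof (intro conjI allI impI ballI)
  fix e assume "e \<in> Upsilon m \<inter> {2 / (3 * real m) <..< 1 - 2 / (3 * real m)}"
  then show "rho_check p m e > 1" using assms by (intro rho_check_gt_1)
next
  fix \<nu> :: nat and c :: real
  assume "c > 0 \<and> c \<notin> \<int> \<and> real m * c \<notin> \<int>"
  then have mc: "real m * c \<notin> \<int>" by blast
  define \<rho> where "\<rho> = rho_check p m (frac c)"
  define R where "R n = cmod (aligned_radius p m \<nu> c (2 * pi / real n))" for n
  \<comment> \<open>For \<open>\<rho> > 0\<close> the correction makes the bound equal to the radius of the characteristic mode.
    Otherwise the bound is at most \<open>0\<close>, below any radius.\<close>
  define g where "g n = (if \<rho> > 0 then R n / \<rho> - 1 else 0)" for n
  have freq: "filterlim (\<lambda>n. 2 * pi / real n) (at 0) sequentially"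
    unfolding filterlim_at by (auto intro: tendsto_divide_0 filterlim_real_at_infinity_sequentially
        intro!: eventually_mono[OF eventually_gt_at_top[of 0]])
  have "(\<lambda>n. aligned_radius p m \<nu> c (2 * pi / real n) - (- of_real \<rho>))
      \<in> O(\<lambda>n. of_real (2 * pi / real n))"
    using landau_o.big.compose[OF aligned_radius_limit[OF assms(1) mc, of \<nu>] freq] by (simp add: \<rho>_def)
  then have "(\<lambda>n. cmod (aligned_radius p m \<nu> c (2 * pi / real n) - (- of_real \<rho>))) \<in> O(\<lambda>n. 2 * pi / real n)"
    by (subst (asm) landau_o.big.norm_iff[symmetric]) (simp add: norm_divide)
  moreover have "(\<lambda>n. 2 * pi / real n) \<in> O(mesh_width)"
    by (rule bigoI[of _ pi]) (simp add: mesh_width_def mult.commute)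
  ultimately have close: "(\<lambda>n. cmod (aligned_radius p m \<nu> c (2 * pi / real n) - (- of_real \<rho>))) \<in> O(mesh_width)"
    by (rule landau_o.big.trans)
  have g: "g \<in> O(mesh_width)"
  proof (cases "\<rho> > 0")
    case True
    have "(\<lambda>n. R n - \<rho>) \<in> O(\<lambda>n. cmod (aligned_radius p m \<nu> c (2 * pi / real n) - (- of_real \<rho>)))"
    proof (rule bigoI[of _ 1], intro always_eventually allI)
      fix n
      show "norm (R n - \<rho>) \<le> 1 * norm (cmod (aligned_radius p m \<nu> c (2 * pi / real n) - (- of_real \<rho>)))"
        using norm_triangle_ineq3[of "aligned_radius p m \<nu> c (2 * pi / real n)" "- of_real \<rho>"] True
        by (simp add: R_def)
    qed
    from landau_o.big.trans[OF this close] have "(\<lambda>n. 1 / \<rho> * (R n - \<rho>)) \<in> O(mesh_width)"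
      by (subst landau_o.big.cmult_in_iff) (use True in auto)
    also have "(\<lambda>n. 1 / \<rho> * (R n - \<rho>)) = g" using True by (auto simp: g_def field_simps)
    finally show ?thesis .
  next
    case False
    then have "g = (\<lambda>_. 0)" by (auto simp: g_def)
    then show ?thesis by simp
  qed
  show "\<exists>g :: nat \<Rightarrow> real. g \<in> O(mesh_width) \<and>
              (\<forall>\<^sub>F n in sequentially. \<forall>\<alpha> \<delta>t :: real.
                 \<alpha> > 0 \<and> \<delta>t > 0 \<and> \<alpha> * \<delta>t / mesh_width n = c \<longrightarrow>
                 max_mgrit_spectral_radius m \<nu> n
                   (semi_lagrangian p n \<alpha> \<delta>t) (semi_lagrangian p n \<alpha> (real m * \<delta>t))
                 \<ge> ereal (rho_check p m (frac c) * (1 + g n)))"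
  proof (intro exI[of _ g] conjI g eventually_mono[OF eventually_gt_at_top[of 2]] allI impI)
    fix n :: nat and \<alpha> \<delta>t :: real
    assume n: "2 < n" and h: "\<alpha> > 0 \<and> \<delta>t > 0 \<and> \<alpha> * \<delta>t / mesh_width n = c"
    have "\<rho> * (1 + g n) \<le> R n"
    proof (cases "\<rho> > 0")
      case False
      then have "\<rho> * (1 + g n) \<le> 0" by (simp add: g_def)
      also have "0 \<le> R n" by (simp add: R_def)
      finally show ?thesis .
    qed (simp add: g_def)
    then have "ereal (rho_check p m (frac c) * (1 + g n)) \<le> ereal (R n)" by (simp add: \<rho>_def)
    also have "\<dots> \<le> max_mgrit_spectral_radius m \<nu> n
        (semi_lagrangian p n \<alpha> \<delta>t) (semi_lagrangian p n \<alpha> (real m * \<delta>t))"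
      unfolding R_def using assms n h by (intro aligned_radius_le_max) auto
    finally show "ereal (rho_check p m (frac c) * (1 + g n)) \<le> max_mgrit_spectral_radius m \<nu> n
        (semi_lagrangian p n \<alpha> \<delta>t) (semi_lagrangian p n \<alpha> (real m * \<delta>t))" .
  qed
qed

end
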